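(* Let $d_M, n_M$ be positive integers, let $\rho\in(0,1)$, let $k$ be an integer, and let $(M_i)_{i\le k}$ be a family of real matrices $M_i\in\mathbb R^{d_M\times n_M}$ indexed by all integers $i\le k$. Let $\sigma_M\ge 0$ be such that the maximum singular value of $M_i$ is at most $\sigma_M$ for every $i\le k$. Define $$\bar{\mathcal M}_k = (1-\rho)\sum_{i=-\infty}^{k}\rho^{k-i}M_iM_i^T\in\mathbb R^{d_M\times d_M},$$ and let $\lambda_M$ be the maximum eigenvalue of $\bar{\mathcal M}_k$. Let $\epsilon\in(0,1)$, and assume that $\lambda_M\ge\alpha\sigma_M^2$ for some fixed $\alpha\in(0,1)$. Then at most $\min(r_\epsilon n_M, d_M)$ eigenvalues of $\bar{\mathcal M}_k$ (counted with multiplicity) are above (i.e. strictly greater than) $\epsilon\lambda_M$, where $$r_\epsilon=\left\lceil \frac{\log(\alpha\epsilon)}{\log(\rho)}\right\rceil.$$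
   Context: The matrix $\bar{\mathcal M}_k$ is an exponential average of the matrices $M_iM_i^T$ with decay parameter $\rho\in(0,1)$; the infinite sum converges because the singular values of the $M_i$ are uniformly bounded. It is a real symmetric positive semidefinite $d_M\times d_M$ matrix, so it has $d_M$ real nonnegative eigenvalues counted with multiplicity. $\lceil\cdot\rceil$ denotes the ceiling function and $\log$ the natural logarithm. *)

theory Defs
  imports "HOL-Analysis.Analysis" "HOL-Computational_Algebra.Polynomial"
begin

text \<open>The characteristic polynomial \<open>det (x I - A)\<close>, as a determinant over the ring of polynomials.\<close>

definition charpoly :: "'a::comm_ring_1 ^'n^'n \<Rightarrow> 'a poly" where
  "charpoly A = det (mat [:0, 1:] - (\<chi> i j. [:A $ i $ j:]))"

text \<open>Real eigenvalues, each repeated according to its algebraic multiplicity.\<close>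

definition eigenvalues :: "real^'n^'n \<Rightarrow> real multiset" where
  "eigenvalues A = proots (charpoly A)"

text \<open>\<open>Max\<close> is meaningful only if there is a real eigenvalue; here it is applied to
  symmetric matrices only.\<close>

definition max_eigenvalue :: "real^'n^'n \<Rightarrow> real" where
  "max_eigenvalue A = Max (set_mset (eigenvalues A))"

text \<open>The singular values of a \<open>d \<times> n\<close> matrix are the square roots of the \<open>n\<close> eigenvalues of
  \<open>A\<^sup>T A\<close>. If \<open>n > d\<close>, this list has \<open>n - d\<close> additional zeros compared with the convention of
  \<open>min d n\<close> singular values; the maximum is the same.\<close>

definition singular_values :: "real^'n^'d \<Rightarrow> real multiset" where
  "singular_values A = image_mset sqrt (eigenvalues (transpose A ** A))"

definition max_singular_value :: "real^'n^'d \<Rightarrow> real" where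
  "max_singular_value A = Max (set_mset (singular_values A))"

text \<open>The exponential average. The sum over all integers \<open>i \<le> k\<close> is an unconditional sum in the
  normed space of matrices, and \<open>powi\<close> has the nonnegative exponent \<open>k - i\<close>.\<close>

definition exp_average :: "real \<Rightarrow> int \<Rightarrow> (int \<Rightarrow> real^'n^'d) \<Rightarrow> real^'d^'d" where
  "exp_average \<rho> k M =
     (1 - \<rho>) *\<^sub>R (\<Sum>\<^sub>\<infinity>i\<in>{..k}. (\<rho> powi (k - i)) *\<^sub>R (M i ** transpose (M i)))"

lemma poly_charpoly: "poly (charpoly A) x = det (mat x - A)"
  by (simp add: charpoly_def det_def poly_sum poly_prod mat_def if_distrib cong: if_cong)
     (intro sum.cong refl arg_cong2[where f="(*)"] prod.cong, auto simp: sign_def)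

lemma poly_charpoly_eq_0_iff:
  fixes A :: "real^'n^'n"
  shows "poly (charpoly A) x = 0 \<longleftrightarrow> (\<exists>v. v \<noteq> 0 \<and> A *v v = x *\<^sub>R v)"
proof -
  have *: "(mat x - A) *v v = x *\<^sub>R v - A *v v" for v
    by (simp add: matrix_vector_mult_diff_rdistrib)
       (simp add: vec_eq_iff matrix_vector_mult_def mat_def if_distrib if_distribR cong: if_cong)
  have "poly (charpoly A) x = 0 \<longleftrightarrow> \<not> (\<forall>v. (mat x - A) *v v = 0 \<longrightarrow> v = 0)"
    by (metis poly_charpoly invertible_det_nz invertible_left_inverse matrix_left_invertible_ker)
  then show ?thesis by (auto simp: *)
qed

lemma charpoly_nonzero:
  fixes A :: "real^'n^'n"
  shows "charpoly A \<noteq> 0"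
proof
  assume "charpoly A = 0"
  then obtain v where v: "v \<noteq> 0" "A *v v = (onorm ((*v) A) + 1) *\<^sub>R v"
    using poly_charpoly_eq_0_iff[of A] by (metis poly_0)
  have "norm (A *v v) \<le> onorm ((*v) A) * norm v"
    by (intro onorm matrix_vector_mul_bounded_linear)
  moreover have "0 \<le> onorm ((*v) A)"
    by (intro onorm_pos_le matrix_vector_mul_bounded_linear)
  moreover from this have "norm (A *v v) = (onorm ((*v) A) + 1) * norm v"
    unfolding v(2) by simp
  ultimately show False
    using v(1) by (simp add: distrib_right)
qed

lemma in_eigenvalues_iff:
  "x \<in># eigenvalues A \<longleftrightarrow> (\<exists>v. v \<noteq> 0 \<and> A *v v = x *\<^sub>R v)"
  by (simp add: eigenvalues_def charpoly_nonzero poly_charpoly_eq_0_iff)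

end

(* Let r be the rounded-up ratio of logarithms. In the quadratic form of the average, the terms
   with i \<le> k - r contribute at most \<rho> ^ r * \<sigma>^2 * |v|^2 \<le> \<epsilon> * \<lambda> * |v|^2, by the choice of r, while
   the r most recent terms vanish on a subspace of codimension at most r * n. If more than r * n
   eigenvalues exceeded \<epsilon> * \<lambda>, this subspace would meet the span of the corresponding orthonormal
   eigenvectors in a nonzero v, on which the form is greater than \<epsilon> * \<lambda> * |v|^2. *)

theory Submission
  imports Defs
begin

subsection \<open>Diagonalization of symmetric matrices\<close>

text \<open>First-order condition for a minimum at \<open>t = 0\<close>: near 0 the linear term
  would dominate and change sign.\<close>

lemma linear_coeff_zero_if_quadratic_nonneg:
  fixes b c :: real
  assumes "\<And>t. 0 \<le> 2 * t * b + t\<^sup>2 * c" and "0 \<le> c"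
  shows "b = 0"
proof (rule ccontr)
  assume "b \<noteq> 0"
  \<comment> \<open>The shift by 1 keeps the denominator nonzero when \<open>c = 0\<close>.\<close>
  define t where "t = - b / (c + 1)"
  have "c + 1 > 0" using assms(2) by simp
  then have b: "b = - t * (c + 1)" by (simp add: t_def)
  have "2 * t * b + t\<^sup>2 * c = - (t\<^sup>2 * (c + 2))"
    unfolding b by (simp add: algebra_simps power2_eq_square)
  moreover have "t \<noteq> 0" using \<open>b \<noteq> 0\<close> \<open>c + 1 > 0\<close> by (simp add: t_def)
  then have "0 < t\<^sup>2 * (c + 2)" using assms(2) by simp
  ultimately show False using assms(1)[of t] by simp
qed

text \<open>The quadratic form of \<open>A\<close> attains its maximum on the compact unit sphere of
  \<open>S\<close>, and a maximizer is an eigenvector: the residual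
  \<open>A *v u - m *\<^sub>R u\<close> stays in \<open>S\<close>, so it is an admissible direction
  in which the first derivative must vanish.\<close>

lemma invariant_subspace_unit_eigenvector:
  fixes A :: "real^'n^'n"
  assumes sym: "\<And>x y. x \<bullet> (A *v y) = (A *v x) \<bullet> y"
    and S: "subspace S" "\<And>x. x \<in> S \<Longrightarrow> A *v x \<in> S" "S \<noteq> {0}"
  obtains u m where "u \<in> S" "norm u = 1" "A *v u = m *\<^sub>R u"
proof -
  obtain s where s: "s \<in> S" "s \<noteq> 0" using S subspace_0[OF S(1)] by blast
  define K where "K = sphere 0 1 \<inter> S"
  have "compact K" unfolding K_def by (intro compact_Int_closed closed_subspace S(1)) simp
  moreover have "s /\<^sub>R norm s \<in> K" using s S(1) by (simp add: K_def subspace_scale)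
  then have "K \<noteq> {}" by blast
  moreover have "continuous_on K (\<lambda>x. x \<bullet> (A *v x))"
    by (intro continuous_intros linear_continuous_on matrix_vector_mul_bounded_linear)
  ultimately obtain u where u: "u \<in> K" and max: "\<And>x. x \<in> K \<Longrightarrow> x \<bullet> (A *v x) \<le> u \<bullet> (A *v u)"
    using continuous_attains_sup[of K] by blast
  define m where "m = u \<bullet> (A *v u)"
  \<comment> \<open>\<open>q\<close> is the gap between the maximum \<open>m\<close>, scaled by
    homogeneity, and the form. It is nonnegative on \<open>S\<close> and zero at \<open>u\<close>,
    so \<open>u\<close> minimizes it.\<close>
  define q where "q x = m * (x \<bullet> x) - x \<bullet> (A *v x)" for x
  have q_nonneg: "0 \<le> q x" if "x \<in> S" for x
  proof (cases "x = 0")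
    case False
    have "x /\<^sub>R norm x \<in> K" using that S(1) False by (simp add: K_def subspace_scale)
    from max[OF this] have "(x \<bullet> (A *v x)) / (norm x)\<^sup>2 \<le> m"
      by (simp add: m_def matrix_vector_mult_scaleR power2_eq_square divide_simps)
    then show ?thesis
      using False by (simp add: q_def divide_simps flip: power2_norm_eq_inner)
  qed (simp add: q_def)
  have uS: "u \<in> S" and u1: "norm u = 1" using u by (auto simp: K_def)
  have q_u: "q u = 0" using u1 by (simp add: q_def m_def norm_eq_1)
  define w where "w = A *v u - m *\<^sub>R u"
  have wS: "w \<in> S" unfolding w_def by (intro subspace_diff subspace_scale S uS)
  \<comment> \<open>By symmetry of \<open>A\<close> the two mixed terms agree. With \<open>w\<close>
    the residual, the linear coefficient turns out to be \<open>- (w \<bullet> w)\<close>, so its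
    vanishing forces \<open>w = 0\<close>.\<close>
  have "q (u + t *\<^sub>R w) = q u + 2 * t * (m * (w \<bullet> u) - w \<bullet> (A *v u)) + t\<^sup>2 * q w" for t
  proof -
    have *: "u \<bullet> (A *v w) = w \<bullet> (A *v u)" "u \<bullet> w = w \<bullet> u"
      by (metis sym inner_commute)+
    show ?thesis
      unfolding q_def matrix_vector_right_distrib matrix_vector_mult_scaleR inner_add_left
        inner_add_right inner_scaleR_left inner_scaleR_right *
      by algebra
  qed
  moreover have "m * (w \<bullet> u) - w \<bullet> (A *v u) = - (w \<bullet> w)"
    using inner_diff_right[of w "A *v u" "m *\<^sub>R u"] by (simp flip: w_def)
  ultimately have nonneg: "0 \<le> 2 * t * (- (w \<bullet> w)) + t\<^sup>2 * q w" for t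
    using q_nonneg[of "u + t *\<^sub>R w"] q_u uS wS S(1) by (simp add: subspace_add subspace_scale)
  have "- (w \<bullet> w) = 0"
    using nonneg q_nonneg[OF wS] by (rule linear_coeff_zero_if_quadratic_nonneg)
  then have "w = 0" unfolding neg_equal_0_iff_equal inner_eq_zero_iff .
  then have "A *v u = m *\<^sub>R u" unfolding w_def by (rule right_minus_eq[THEN iffD1])
  with uS u1 show thesis by (rule that)
qed

text \<open>Induction on the dimension: split off a unit eigenvector \<open>u\<close>. Its
  orthogonal complement in \<open>S\<close> is again invariant, because
  \<open>u \<bullet> (A *v y) = m * (u \<bullet> y)\<close> by symmetry.\<close>

lemma invariant_subspace_orthonormal_eigenbasis:
  fixes A :: "real^'n^'n"
  assumes sym: "\<And>x y. x \<bullet> (A *v y) = (A *v x) \<bullet> y"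
    and "subspace S" "\<And>x. x \<in> S \<Longrightarrow> A *v x \<in> S"
  shows "\<exists>B. pairwise orthogonal B \<and> (\<forall>b\<in>B. norm b = 1 \<and> (\<exists>m. A *v b = m *\<^sub>R b)) \<and> span B = S"
  using assms(2,3)
proof (induction "dim S" arbitrary: S rule: less_induct)
  case less
  show ?case
  proof (cases "S = {0}")
    case True
    then show ?thesis by (intro exI[of _ "{}"]) auto
  next
    case False
    obtain u m where u: "u \<in> S" "norm u = 1" "A *v u = m *\<^sub>R u"
      using invariant_subspace_unit_eigenvector[OF sym less.prems False] by blast
    define T where "T = {y \<in> S. u \<bullet> y = 0}"
    have T: "subspace T"
      using less.prems(1) by (auto simp: T_def subspace_def inner_simps)
    have "T \<subseteq> S" "u \<notin> T" using u(2) by (auto simp: T_def norm_eq_1)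
    then have "dim T < dim S"
      using u(1) T less.prems(1) by (metis dim_psubset psubsetI span_eq_iff)
    moreover have "A *v y \<in> T" if "y \<in> T" for y
      using that u(3) less.prems(2) by (simp add: T_def sym)
    ultimately obtain B where B: "pairwise orthogonal B"
      "\<forall>b\<in>B. norm b = 1 \<and> (\<exists>m. A *v b = m *\<^sub>R b)" "span B = T"
      using less.hyps T by blast
    have "B \<subseteq> T" using B(3) span_superset by blast
    then have "pairwise orthogonal (insert u B)"
      using B(1) by (auto simp: pairwise_insert T_def orthogonal_def inner_commute)
    moreover have "span (insert u B) = S"
    proof
      show "span (insert u B) \<subseteq> S"
        using \<open>B \<subseteq> T\<close> \<open>T \<subseteq> S\<close> u(1) less.prems(1) by (intro span_minimal) auto
      show "S \<subseteq> span (insert u B)"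
      proof
        fix x assume "x \<in> S"
        then have "x - (u \<bullet> x) *\<^sub>R u \<in> T"
          using u(1,2) less.prems(1)
          by (simp add: T_def subspace_diff subspace_scale inner_simps norm_eq_1)
        then show "x \<in> span (insert u B)" using B(3) by (auto simp: span_insert)
      qed
    qed
    ultimately show ?thesis using B(2) u by (intro exI[of _ "insert u B"]) auto
  qed
qed

text \<open>Spanning need not be demanded: orthonormal vectors indexed by \<open>'n\<close> are a
  basis by their number. A function \<open>d\<close>, unlike a set of eigenvalues, keeps repetitions
  and hence multiplicities.\<close>

definition orthonormal_eigenbasis :: "real^'n^'n \<Rightarrow> ('n \<Rightarrow> real^'n) \<Rightarrow> ('n \<Rightarrow> real) \<Rightarrow> bool" where
  "orthonormal_eigenbasis A f d \<longleftrightarrow>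
     (\<forall>i j. f i \<bullet> f j = (if i = j then 1 else 0)) \<and> (\<forall>i. A *v f i = d i *\<^sub>R f i)"

theorem symmetric_orthonormal_eigenbasis:
  fixes A :: "real^'n^'n"
  assumes "\<And>x y. x \<bullet> (A *v y) = (A *v x) \<bullet> y"
  obtains f d where "orthonormal_eigenbasis A f d"
proof -
  obtain B where B: "pairwise orthogonal B"
    "\<And>b. b \<in> B \<Longrightarrow> norm b = 1" "\<And>b. b \<in> B \<Longrightarrow> \<exists>m. A *v b = m *\<^sub>R b" "span B = UNIV"
    using invariant_subspace_orthonormal_eigenbasis[OF assms subspace_UNIV] by auto
  have "0 \<notin> B" using B(2) by force
  then have ind: "independent B" using B(1) by (intro pairwise_orthogonal_independent)
  then have "card B = CARD('n)"
    using dim_span_eq_card_independent[of B] B(4) by simp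
  moreover have "finite B" using ind by (rule independent_imp_finite)
  ultimately obtain f where f: "bij_betw f (UNIV :: 'n set) B"
    by (metis finite_same_card_bij finite)
  have fB: "f i \<in> B" for i using f by (auto simp: bij_betw_def)
  obtain d where "\<And>i. A *v f i = d i *\<^sub>R f i" using B(3)[OF fB] by metis
  moreover have "f i \<bullet> f j = (if i = j then 1 else 0)" for i j
  proof (cases "i = j")
    case False
    then have "f i \<noteq> f j" using f by (auto simp: bij_betw_def inj_def)
    then show ?thesis using B(1) fB False by (simp add: pairwise_def orthogonal_def)
  qed (use B(2)[OF fB] in \<open>simp add: norm_eq_1\<close>)
  ultimately show thesis by (intro that) (auto simp: orthonormal_eigenbasis_def)
qed

section \<open>Coordinates and spectrum with respect to an orthonormal eigenbasis\<close>

lemma orthonormal_eigenbasis_expansion: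
  assumes "orthonormal_eigenbasis A f d"
  shows "(\<Sum>i\<in>UNIV. (x \<bullet> f i) *\<^sub>R f i) = x"
proof -
  have o: "f i \<bullet> f j = (if i = j then 1 else 0)" for i j
    using assms by (simp add: orthonormal_eigenbasis_def)
  have inj: "inj f" by (rule injI) (metis o zero_neq_one)
  have pw: "pairwise orthogonal (range f)" by (auto simp: pairwise_def orthogonal_def o)
  have n1: "norm b = 1" if "b \<in> range f" for b using that o by (auto simp: norm_eq_1)
  then have "0 \<notin> range f" by fastforce
  then have "independent (range f)" using pw by (intro pairwise_orthogonal_independent)
  moreover have "card (range f) = dim (UNIV :: (real^'a) set)" using inj by (simp add: card_image)
  ultimately have "span (range f) = UNIV"
    using card_ge_dim_independent[of "range f" UNIV] by auto
  then have "(\<Sum>b\<in>range f. (x \<bullet> b) *\<^sub>R b) = x"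
    using pw n1 by (intro orthonormal_basis_expand) auto
  then show ?thesis using inj by (simp add: sum.reindex)
qed

lemma orthonormal_eigenbasis_quadratic_form:
  assumes "orthonormal_eigenbasis A f d"
  shows "x \<bullet> (A *v x) = (\<Sum>i\<in>UNIV. d i * (x \<bullet> f i)\<^sup>2)"
proof -
  have "A *v x = (\<Sum>i\<in>UNIV. (x \<bullet> f i) *\<^sub>R (d i *\<^sub>R f i))"
    using assms by (subst orthonormal_eigenbasis_expansion[OF assms, symmetric, of x])
      (simp add: linear_sum[OF matrix_vector_mul_linear] matrix_vector_mult_scaleR
        orthonormal_eigenbasis_def)
  then show ?thesis by (simp add: inner_sum_right power2_eq_square mult_ac)
qed

lemma orthonormal_eigenbasis_norm:
  assumes "orthonormal_eigenbasis A f d"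
  shows "(norm x)\<^sup>2 = (\<Sum>i\<in>UNIV. (x \<bullet> f i)\<^sup>2)"
proof -
  have "x \<bullet> x = x \<bullet> (\<Sum>i\<in>UNIV. (x \<bullet> f i) *\<^sub>R f i)"
    by (simp add: orthonormal_eigenbasis_expansion[OF assms])
  then show ?thesis unfolding power2_norm_eq_inner by (simp add: inner_sum_right power2_eq_square)
qed

text \<open>The matrix \<open>P\<close> with columns \<open>f j\<close> diagonalizes
  \<open>A\<close>, so the characteristic polynomial splits into the factors \<open>x - d i\<close>.
  This links algebraic multiplicity to the number of indices \<open>i\<close> with a given value
  \<open>d i\<close>.\<close>

lemma eigenvalues_orthonormal_eigenbasis:
  fixes A :: "real^'n^'n"
  assumes "orthonormal_eigenbasis A f d"
  shows "eigenvalues A = image_mset d (mset_set UNIV)"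
proof -
  define P :: "real^'n^'n" where "P = (\<chi> i j. f j $ i)"
  define D where "D x = (\<chi> i j. if i = j then x - d i else 0)" for x :: real
  have o: "f i \<bullet> f j = (if i = j then 1 else 0)" and e: "A *v f i = d i *\<^sub>R f i" for i j
    using assms by (simp_all add: orthonormal_eigenbasis_def)
  have "transpose P ** P = mat 1"
    using o by (simp add: P_def vec_eq_iff matrix_matrix_mult_def transpose_def mat_def
        inner_vec_def)
  then have detP: "det P \<noteq> 0"
    by (metis invertible_det_nz invertible_left_inverse)
  have *: "(mat x - A) ** P = P ** D x" for x
  proof -
    have mat_x: "mat x *v v = x *\<^sub>R v" for v :: "real^'n"
      by (simp add: vec_eq_iff matrix_vector_mult_def mat_def if_distrib if_distribR cong: if_cong)
    have "((mat x - A) ** P) $ i $ j = (P ** D x) $ i $ j" for i j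
    proof -
      have "((mat x - A) ** P) $ i $ j = ((mat x - A) *v f j) $ i"
        by (simp add: matrix_matrix_mult_def matrix_vector_mult_def P_def)
      also have "(mat x - A) *v f j = (x - d j) *\<^sub>R f j"
        by (simp add: matrix_vector_mult_diff_rdistrib e mat_x scaleR_left_diff_distrib)
      also have "\<dots> $ i = (P ** D x) $ i $ j"
        by (simp add: matrix_matrix_mult_def P_def D_def if_distrib cong: if_cong)
      finally show ?thesis .
    qed
    then show ?thesis by (simp add: vec_eq_iff)
  qed
  \<comment> \<open>Equality is shown pointwise; over the reals it implies equality of the
    polynomials.\<close>
  have "poly (charpoly A) x = poly (\<Prod>i\<in>UNIV. [:- d i, 1:]) x" for x
  proof -
    have "det (mat x - A) * det P = det P * det (D x)"
      by (metis * det_mul)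
    then have "det (mat x - A) = det (D x)" using detP by simp
    also have "\<dots> = (\<Prod>i\<in>UNIV. x - d i)"
      by (subst det_diagonal) (simp_all add: D_def)
    finally show ?thesis by (simp add: poly_charpoly poly_prod)
  qed
  then have "charpoly A = (\<Prod>i\<in>UNIV. [:- d i, 1:])" by (simp add: fun_eq_iff flip: poly_eq_poly_eq_iff)
  then show ?thesis
    by (simp add: eigenvalues_def proots_prod sum_unfold_sum_mset)
qed

subsection \<open>Singular values and the exponential average\<close>

lemma transpose_inner:
  fixes A :: "real^'n^'m"
  shows "(transpose A *v x) \<bullet> y = x \<bullet> (A *v y)"
  by (metis dot_lmul_matrix vector_transpose_matrix transpose_transpose)

text \<open>In an orthonormal eigenbasis of the Gram matrix, the squared norm of
  \<open>A *v x\<close> is a combination of squared coordinates of \<open>x\<close> whose weights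
  \<open>d i\<close> are squared singular values.\<close>

lemma norm_mult_le_max_singular_value:
  fixes A :: "real^'n^'d"
  shows "norm (A *v x) \<le> max_singular_value A * norm x"
proof -
  define G where "G = transpose A ** A"
  have G: "y \<bullet> (G *v z) = (A *v y) \<bullet> (A *v z)" for y z
    by (metis G_def matrix_vector_mul_assoc transpose_inner inner_commute)
  obtain f d where fd: "orthonormal_eigenbasis G f d"
    using symmetric_orthonormal_eigenbasis[of G] by (metis G inner_commute)
  have s: "sqrt (d i) \<le> max_singular_value A" and d: "0 \<le> d i" for i
  proof -
    show "sqrt (d i) \<le> max_singular_value A"
      using eigenvalues_orthonormal_eigenbasis[OF fd]
      by (auto simp: max_singular_value_def singular_values_def G_def intro!: Max_ge)
    have "d i = f i \<bullet> (G *v f i)"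
      using fd by (simp add: orthonormal_eigenbasis_def)
    then show "0 \<le> d i" by (simp add: G)
  qed
  \<comment> \<open>\<open>undefined\<close> serves as an arbitrary index; one exists because types
    are nonempty.\<close>
  have s0: "0 \<le> max_singular_value A"
    using s[of undefined] d[of undefined] by (meson order_trans real_sqrt_ge_zero)
  have "(norm (A *v x))\<^sup>2 = (\<Sum>i\<in>UNIV. d i * (x \<bullet> f i)\<^sup>2)"
    using orthonormal_eigenbasis_quadratic_form[OF fd, of x]
    by (simp add: G power2_norm_eq_inner)
  also have "\<dots> \<le> (\<Sum>i\<in>UNIV. (max_singular_value A)\<^sup>2 * (x \<bullet> f i)\<^sup>2)"
    using s by (intro sum_mono mult_right_mono) (simp_all add: sqrt_le_D)
  also have "\<dots> = (max_singular_value A * norm x)\<^sup>2"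
    by (simp add: orthonormal_eigenbasis_norm[OF fd] power_mult_distrib sum_distrib_left)
  finally show ?thesis using s0 by (auto intro: power2_le_imp_le)
qed

text \<open>The bound passes to the transpose with the same constant: with \<open>y\<close> the
  image of \<open>x\<close>, \<open>norm y * norm y = x \<bullet> (A *v y)\<close> is at most
  \<open>norm x\<close> times the bound for \<open>A *v y\<close>, and one factor
  \<open>norm y\<close> cancels.\<close>

lemma norm_transpose_mult_le_max_singular_value:
  fixes A :: "real^'n^'d"
  shows "norm (transpose A *v x) \<le> max_singular_value A * norm x"
proof (cases "transpose A *v x = 0")
  case True
  \<comment> \<open>Only the sign of the constant matters here; a unit vector reveals it.\<close>
  have "0 \<le> max_singular_value A * norm (axis undefined 1 :: real^'n)"
    by (rule order_trans[OF norm_ge_zero norm_mult_le_max_singular_value])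
  then show ?thesis using True by (simp add: norm_axis_1)
next
  case False
  define y where "y = transpose A *v x"
  have "norm y * norm y = x \<bullet> (A *v y)"
    by (metis y_def transpose_inner norm_eq_sqrt_inner power2_eq_square power2_norm_eq_inner)
  also have "\<dots> \<le> norm x * norm (A *v y)" by (rule norm_cauchy_schwarz)
  also have "\<dots> \<le> norm x * (max_singular_value A * norm y)"
    by (intro mult_left_mono norm_mult_le_max_singular_value) simp
  finally have "norm y * norm y \<le> (max_singular_value A * norm x) * norm y"
    by (simp add: mult_ac)
  then show ?thesis using False by (simp add: y_def)
qed

text \<open>Reduces the matrix series to scalar series indexed by the age \<open>j = k - i\<close>.
  The matrix series converges absolutely, and evaluating the bilinear form is a bounded linear map
  of the matrix, so it commutes with the sum.\<close>

lemma has_sum_exp_average_form: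
  fixes M :: "int \<Rightarrow> real^'n^'d"
  assumes \<rho>: "0 < \<rho>" "\<rho> < 1"
    and bound: "\<And>i x. i \<le> k \<Longrightarrow> norm (transpose (M i) *v x) \<le> \<sigma> * norm x"
  shows "((\<lambda>j. (1 - \<rho>) * (\<rho> ^ j * ((transpose (M (k - int j)) *v x) \<bullet> (transpose (M (k - int j)) *v y))))
           has_sum x \<bullet> (exp_average \<rho> k M *v y)) UNIV"
proof -
  define G where "G i = M i ** transpose (M i)" for i
  have G: "v \<bullet> (G i *v w) = (transpose (M i) *v v) \<bullet> (transpose (M i) *v w)" for i v w
    by (metis G_def matrix_vector_mul_assoc transpose_inner)
  have entry: "\<bar>G i $ a $ b\<bar> \<le> \<sigma> * \<sigma>" if "i \<le> k" for i a b
  proof -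
    have "G i $ a $ b = axis a 1 \<bullet> (G i *v axis b 1)"
      by (simp add: inner_axis' matrix_vector_mult_basis column_def)
    also have "\<bar>\<dots>\<bar> \<le> norm (transpose (M i) *v axis a 1) * norm (transpose (M i) *v axis b 1)"
      unfolding G by (rule Cauchy_Schwarz_ineq2)
    also have "\<dots> \<le> \<sigma> * \<sigma>"
      using bound[OF that, of "axis a 1"] bound[OF that, of "axis b 1"]
      by (intro mult_mono') (simp_all add: norm_axis_1)
    finally show ?thesis .
  qed
  \<comment> \<open>Any bound uniform in \<open>i\<close> suffices for comparison with a geometric
    series; this one adds up the bound of every entry.\<close>
  define C where "C = (\<Sum>a\<in>(UNIV::'d set). \<Sum>b\<in>(UNIV::'d set). \<sigma> * \<sigma>)"
  have "norm (G i) \<le> C" if "i \<le> k" for i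
  proof -
    have "norm (G i) \<le> (\<Sum>a\<in>UNIV. norm (G i $ a))"
      by (simp add: norm_vec_def[of "G i"] L2_set_le_sum)
    also have "\<dots> \<le> C" unfolding C_def
      by (intro sum_mono order_trans[OF norm_le_l1_cart] entry that)
    finally show ?thesis .
  qed
  then have le: "norm (norm (\<rho> ^ j *\<^sub>R G (k - int j))) \<le> C * \<rho> ^ j" for j
    using \<rho> by (simp add: mult.commute)
  \<comment> \<open>Since \<open>infsum\<close> defaults to 0 on families that are not summable,
    convergence must be secured before the sum in \<open>exp_average\<close> has its intended
    value.\<close>
  have "summable (\<lambda>j. C * \<rho> ^ j)" using \<rho> by (intro summable_mult summable_geometric) simp
  then have "summable (\<lambda>j. norm (\<rho> ^ j *\<^sub>R G (k - int j)))"
    by (rule summable_comparison_test'[where N = 0]) (rule le)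
  then have "(\<lambda>j. \<rho> ^ j *\<^sub>R G (k - int j)) summable_on UNIV"
    by (rule norm_summable_imp_summable_on)
  moreover have "bij_betw (\<lambda>j. k - int j) UNIV {..k}"
    by (rule bij_betwI[where g = "\<lambda>i. nat (k - i)"]) auto
  then have "infsum (\<lambda>j. \<rho> powi (k - (k - int j)) *\<^sub>R G (k - int j)) UNIV
      = infsum (\<lambda>i. \<rho> powi (k - i) *\<^sub>R G i) {..k}"
    by (rule infsum_reindex_bij_betw)
  ultimately have *: "((\<lambda>j. \<rho> ^ j *\<^sub>R G (k - int j)) has_sum
      (\<Sum>\<^sub>\<infinity>i\<in>{..k}. \<rho> powi (k - i) *\<^sub>R G i)) UNIV"
    by (simp add: summable_iff_has_sum_infsum)
  have "linear (\<lambda>B. x \<bullet> (((1 - \<rho>) *\<^sub>R B) *v y))"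
    by (rule linearI)
      (simp_all add: matrix_vector_mult_add_rdistrib scaleR_matrix_vector_assoc[symmetric]
        inner_simps algebra_simps)
  then have "bounded_linear (\<lambda>B. x \<bullet> (((1 - \<rho>) *\<^sub>R B) *v y))"
    by (simp add: linear_conv_bounded_linear)
  from has_sum_bounded_linear[OF this *] show ?thesis
    by (simp add: exp_average_def G_def[symmetric] G mult.assoc scaleR_matrix_vector_assoc[symmetric])
qed

section \<open>Counting the large eigenvalues of the exponential average\<close>

theorem proposition3p1:
  fixes M :: "int \<Rightarrow> real^'n^'d" and k :: int and \<rho> \<sigma> \<alpha> \<epsilon> :: real
  assumes "0 < \<rho>" "\<rho> < 1"
    and "0 \<le> \<sigma>"
    and "\<And>i. i \<le> k \<Longrightarrow> max_singular_value (M i) \<le> \<sigma>"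
    and "0 < \<epsilon>" "\<epsilon> < 1"
    and "0 < \<alpha>" "\<alpha> < 1"
    and "max_eigenvalue (exp_average \<rho> k M) \<ge> \<alpha> * \<sigma>\<^sup>2"
  shows "int (size {#\<mu> \<in># eigenvalues (exp_average \<rho> k M).
                \<mu> > \<epsilon> * max_eigenvalue (exp_average \<rho> k M)#})
         \<le> min (\<lceil>ln (\<alpha> * \<epsilon>) / ln \<rho>\<rceil> * int CARD('n)) (int CARD('d))"
proof -
  define S where "S = exp_average \<rho> k M"
  define c where "c = \<epsilon> * max_eigenvalue S"
  define N where "N j = transpose (M (k - int j))" for j
  define r where "r = nat \<lceil>ln (\<alpha> * \<epsilon>) / ln \<rho>\<rceil>"
  have \<alpha>\<epsilon>: "0 < \<alpha> * \<epsilon>" "\<alpha> * \<epsilon> < 1"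
    using assms(5-8) mult_strict_mono[of \<alpha> 1 \<epsilon> 1] by simp_all
  have ln_neg: "ln \<rho> < 0" "ln (\<alpha> * \<epsilon>) < 0" using assms(1,2) \<alpha>\<epsilon> by simp_all
  \<comment> \<open>Positivity of the ratio ensures that \<open>nat\<close> truncates nothing in
    \<open>r\<close>.\<close>
  then have "0 < ln (\<alpha> * \<epsilon>) / ln \<rho>" by (simp add: divide_neg_neg)
  then have r_int: "\<lceil>ln (\<alpha> * \<epsilon>) / ln \<rho>\<rceil> = int r"
    by (simp add: r_def)
  then have "ln (\<alpha> * \<epsilon>) / ln \<rho> \<le> real r" by linarith
  then have "real r * ln \<rho> \<le> ln (\<alpha> * \<epsilon>)" using ln_neg by (simp add: neg_divide_le_eq)
  then have "ln (\<rho> ^ r) \<le> ln (\<alpha> * \<epsilon>)" using assms(1) by (simp add: ln_realpow)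
  then have "\<rho> ^ r \<le> \<alpha> * \<epsilon>" using assms(1) \<alpha>\<epsilon> by (subst (asm) ln_le_cancel_iff) auto
  \<comment> \<open>The left side is the total weight of the terms of age at least \<open>r\<close>
    times the bound on each; the hypothesis on the maximum eigenvalue puts it below the threshold
    \<open>c\<close>.\<close>
  then have "\<rho> ^ r * \<sigma>\<^sup>2 \<le> \<epsilon> * (\<alpha> * \<sigma>\<^sup>2)"
    using mult_right_mono[of "\<rho> ^ r" "\<alpha> * \<epsilon>" "\<sigma>\<^sup>2"] by (simp add: mult_ac)
  also have "\<dots> \<le> c" unfolding c_def S_def using assms(5,9) by (intro mult_left_mono) auto
  finally have rc: "\<rho> ^ r * \<sigma>\<^sup>2 \<le> c" .
  have bound: "norm (transpose (M i) *v x) \<le> \<sigma> * norm x" if "i \<le> k" for i x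
    using norm_transpose_mult_le_max_singular_value[of "M i" x]
      mult_right_mono[OF assms(4)[OF that], of "norm x"] by simp
  have form: "((\<lambda>j. (1 - \<rho>) * (\<rho> ^ j * ((N j *v x) \<bullet> (N j *v y)))) has_sum x \<bullet> (S *v y)) UNIV" for x y
    unfolding N_def S_def using assms(1,2) bound by (rule has_sum_exp_average_form)
  \<comment> \<open>Each term of the series is symmetric in \<open>x\<close> and \<open>y\<close>,
    hence so is the sum.\<close>
  have "x \<bullet> (S *v y) = (S *v x) \<bullet> y" for x y
    using infsumI[OF form[of x y]] infsumI[OF form[of y x]] by (simp add: inner_commute)
  then obtain f d where fd: "orthonormal_eigenbasis S f d"
    using symmetric_orthonormal_eigenbasis by blast
  have eig: "eigenvalues S = image_mset d (mset_set UNIV)"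
    using fd by (rule eigenvalues_orthonormal_eigenbasis)
  define L where "L = {i. d i > c}"
  have size: "size {#\<mu> \<in># eigenvalues S. \<mu> > c#} = card L"
    by (simp add: eig filter_mset_image_mset L_def)
  have "card L \<le> CARD('d)" by (simp add: card_mono)
  moreover have "card L \<le> r * CARD('n)"
  proof (rule ccontr)
    assume "\<not> card L \<le> r * CARD('n)"
    \<comment> \<open>A vector orthogonal to \<open>X\<close> is annihilated by the \<open>r\<close>
      most recent \<open>N j\<close>, whose rows are in \<open>X\<close>, and has coordinates only
      along \<open>f i\<close> with \<open>i \<in> L\<close>. The negated bound leaves
      \<open>X\<close> fewer than \<open>CARD('d)\<close> elements, so a nonzero such vector
      exists.\<close>
    define X where "X = (\<lambda>(j, a). N j $ a) ` ({..<r} \<times> (UNIV :: 'n set)) \<union> f ` (- L)"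
    have "card X \<le> card ({..<r} \<times> (UNIV :: 'n set)) + card (- L)"
      unfolding X_def by (intro order_trans[OF card_Un_le] add_mono card_image_le) simp_all
    also have "\<dots> = r * CARD('n) + (CARD('d) - card L)"
      by (simp add: card_cartesian_product Compl_eq_Diff_UNIV card_Diff_subset)
    also have "\<dots> < CARD('d)"
      using \<open>\<not> card L \<le> r * CARD('n)\<close> \<open>card L \<le> CARD('d)\<close> by linarith
    finally have "card X < CARD('d)" .
    moreover have "finite X" by (simp add: X_def)
    ultimately have "dim X < DIM(real^'d)"
      using dim_le_card'[of X] by simp
    then obtain v where v: "v \<noteq> 0" "\<And>x. x \<in> X \<Longrightarrow> v \<bullet> x = 0"
      using orthogonal_to_subspace_exists[of X] by (metis orthogonal_def span_base)
    have Nv: "N j *v v = 0" if "j < r" for j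
    proof -
      have "N j $ a \<bullet> v = 0" for a
        using v(2)[of "N j $ a"] that by (force simp: X_def inner_commute)
      then show ?thesis by (simp add: matrix_mult_dot vec_eq_iff)
    qed
    have "v \<bullet> (S *v v) \<le> \<rho> ^ r * \<sigma>\<^sup>2 * (norm v)\<^sup>2"
    proof (rule sums_le)
      show "(\<lambda>j. (1 - \<rho>) * (\<rho> ^ j * ((N j *v v) \<bullet> (N j *v v)))) sums (v \<bullet> (S *v v))"
        using form by (rule has_sum_imp_sums)
      \<comment> \<open>A majorant that uses the vanishing of the terms with \<open>j < r\<close>
        and the bound \<open>\<sigma>\<close> on the rest. The factor \<open>1 - \<rho>\<close>
        cancels the sum of the geometric series, leaving \<open>\<rho> ^ r\<close>.\<close>
      define h where "h j = (if j < r then 0 else (1 - \<rho>) * \<rho> ^ j * (\<sigma>\<^sup>2 * (norm v)\<^sup>2))" for j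
      have "(\<lambda>j. (1 - \<rho>) * \<rho> ^ r * (\<sigma>\<^sup>2 * (norm v)\<^sup>2) * \<rho> ^ j) sums
          ((1 - \<rho>) * \<rho> ^ r * (\<sigma>\<^sup>2 * (norm v)\<^sup>2) * (1 / (1 - \<rho>)))"
        using assms(1,2) by (intro sums_mult geometric_sums) simp
      then have "(\<lambda>j. h (j + r)) sums (\<rho> ^ r * \<sigma>\<^sup>2 * (norm v)\<^sup>2)"
        using assms(2) by (simp add: h_def power_add mult_ac)
      then show "h sums (\<rho> ^ r * \<sigma>\<^sup>2 * (norm v)\<^sup>2)"
        by (subst (asm) sums_iff_shift) (simp add: h_def)
      show "(1 - \<rho>) * (\<rho> ^ j * ((N j *v v) \<bullet> (N j *v v))) \<le> h j" for j
      proof (cases "j < r")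
        case False
        have "(norm (N j *v v))\<^sup>2 \<le> (\<sigma> * norm v)\<^sup>2"
          unfolding N_def by (intro power_mono bound) simp_all
        then have "(1 - \<rho>) * \<rho> ^ j * (norm (N j *v v))\<^sup>2 \<le> (1 - \<rho>) * \<rho> ^ j * (\<sigma> * norm v)\<^sup>2"
          using assms(1,2) by (intro mult_left_mono) simp_all
        then show ?thesis
          using False by (simp add: h_def power_mult_distrib mult.assoc flip: power2_norm_eq_inner)
      qed (simp add: Nv h_def)
    qed
    also have "\<dots> \<le> c * (norm v)\<^sup>2" using rc by (intro mult_right_mono) simp_all
    finally have upper: "v \<bullet> (S *v v) \<le> c * (norm v)\<^sup>2" .
    have vf: "v \<bullet> f i = 0" if "i \<notin> L" for i using v(2) that by (simp add: X_def)
    \<comment> \<open>A nonzero coordinate of \<open>v\<close> makes the lower bound strict, which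
      is what contradicts \<open>upper\<close>.\<close>
    obtain i where i: "v \<bullet> f i \<noteq> 0"
    proof (rule ccontr)
      assume "\<not> thesis"
      then have "v \<bullet> f i = 0" for i using that by blast
      then have "(norm v)\<^sup>2 = 0" by (simp add: orthonormal_eigenbasis_norm[OF fd])
      then show False using v(1) by simp
    qed
    \<comment> \<open>Indices outside \<open>L\<close> contribute 0 whatever the sign of
      \<open>d i - c\<close>; inside \<open>L\<close> this factor is positive.\<close>
    have "0 < (\<Sum>i\<in>UNIV. (d i - c) * (v \<bullet> f i)\<^sup>2)"
    proof (rule sum_pos2)
      show "0 < (d i - c) * (v \<bullet> f i)\<^sup>2" using i vf[of i] by (cases "i \<in> L") (auto simp: L_def)
      show "0 \<le> (d j - c) * (v \<bullet> f j)\<^sup>2" for j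
        using vf[of j] by (cases "j \<in> L") (auto simp: L_def)
    qed simp_all
    also have "\<dots> = v \<bullet> (S *v v) - c * (norm v)\<^sup>2"
      unfolding orthonormal_eigenbasis_quadratic_form[OF fd] orthonormal_eigenbasis_norm[OF fd]
        sum_distrib_left sum_subtractf[symmetric] left_diff_distrib ..
    finally show False using upper by simp
  qed
  ultimately show ?thesis
    using size by (simp add: r_int S_def c_def flip: of_nat_mult)
qed

end
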